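(* Let $f\in\operatorname{im}\epsilon$ be a syndrome supported in a box of side length at most $W$ whose coordinatewise-minimal corner is the origin. Then the parallelized division process eliminates $f$ in $O(W)$ rounds, and throughout the process, the syndrome and the accumulated correction are supported in a box of side length $O(W)$.
   Context: Let $R=\mathbb F_2[x_1^{\pm1},\dots,x_D^{\pm1}]$ and $S=\mathbb F_2[x_1,\dots,x_D]$. Consider a translation-invariant stabilizer code on $\mathbb Z^D$ with $q$ qubits and $m$ stabilizer generators per unit cell. $R^{2q}$ is the $R$-module of finitely supported Pauli operators modulo phases; the excitation map $\epsilon:R^{2q}\to R^m$ is the $R$-linear map sending a Pauli error to its syndrome, where the module monomial $x^{\mathbf u}\mathbf e_a$ ($\mathbf u\in\mathbb Z^D$, $\mathbf e_a$ the $a$th standard basis vector) corresponds to the $a$th generator at site $\mathbf u$. Let $\epsilon_+=\operatorname{im}\epsilon\cap S^m$, an $S$-submodule of $S^m$. Term order: choose positive reals $\omega_1,\dots,\omega_D$ such that $\{1,\omega_1,\dots,\omega_D\}$ is linearly independent over $\mathbb Q$ and distinct positive integers $\eta_1,\dots,\eta_m$; set $\Phi(x^{\mathbf u}\mathbf e_a)=\sum_i\omega_iu_i+\eta_a$ for $\mathbf u\in\mathbb Z_{\ge0}^D$, and order module monomials of $S^m$ by $\mu<\nu\iff\Phi(\mu)<\Phi(\nu)$. $\mathrm{LT}(f)$ is the largest monomial in $f\ne0$. $x^{\mathbf u}\mathbf e_a$ is divisible by $x^{\mathbf v}\mathbf e_b$ iff $a=b$ and $v_i\le u_i$ for all $i$.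 Let $G=\{g_1,\dots,g_s\}$ be a (finite) Gröbner basis of $\epsilon_+$: $G\subseteq\epsilon_+$ and the leading term of every non-zero element of $\epsilon_+$ is divisible by some $\mathrm{LT}(g_j)$. Fix finitely supported Paulis $h_j\in R^{2q}$ with $\epsilon h_j=g_j$, write $\mathrm{LT}(g_j)=x^{\mathbf a_j}\mathbf e_{b_j}$, and fix a priority ordering of $G$. Parallelized division process on $f\in\operatorname{im}\epsilon$ supported in a box whose coordinatewise-minimal corner is the origin (so $f\in\epsilon_+$): in one synchronous round, every monomial $x^{\mathbf u}\mathbf e_a$ of the current syndrome that is divisible by $\mathrm{LT}(g_j)$ for at least one $j$ triggers the Pauli move $x^{\mathbf u-\mathbf a_j}h_j$ for the highest-priority such $g_j$; all triggers are computed from the syndrome at the start of the round and all triggered moves are applied simultaneously modulo two, i.e. the syndrome is updated by adding the corresponding $x^{\mathbf u-\mathbf a_j}g_j$ and the accumulated correction by adding the corresponding $x^{\mathbf u-\mathbf a_j}h_j$. "Eliminates" means the syndrome becomes zero. Implied constants in $O(W)$ depend only on the code and the choices of $\Phi$, $G$, $\{h_j\}$; $W\ge1$. *)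

theory Defs
  imports
    "HOL-Analysis.Cartesian_Space"
    "HOL-Library.Poly_Mapping"
    "HOL-Library.Z2"
begin

section \<open>Laurent polynomials over the two-element field\<close>

text \<open>
  A Laurent polynomial in variables indexed by \<open>'d\<close> is a finitely supported map from exponent
  vectors to coefficients; the ring structure on \<^typ>\<open>'a \<Rightarrow>\<^sub>0 'b\<close> is convolution.
  \<open>R\<^sup>n\<close> is \<open>('d laurent)^'n\<close> with the scalar multiplication \<open>*s\<close>.
\<close>

type_synonym 'd laurent = "(int ^ 'd) \<Rightarrow>\<^sub>0 bit"

definition xpow :: "int ^ 'd \<Rightarrow> ('d::finite) laurent" where
  "xpow u = Poly_Mapping.single u 1"

text \<open>The involution \<open>x\<^sup>u \<mapsto> x\<^sup>-\<^sup>u\<close>.\<close>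

definition antipode :: "('d::finite) laurent \<Rightarrow> 'd laurent" where
  "antipode p = Poly_Mapping.map_key uminus p"

text \<open>The pair \<open>(u, a)\<close> encodes the module monomial \<open>x\<^sup>u e\<^sub>a\<close>.\<close>

definition msupp :: "('d::finite) laurent ^ 'n \<Rightarrow> ((int ^ 'd) \<times> 'n) set" where
  "msupp v = {(u, a). u \<in> Poly_Mapping.keys (v $ a)}"

definition sites :: "('d::finite) laurent ^ 'n \<Rightarrow> (int ^ 'd) set" where
  "sites v = (\<Union>a. Poly_Mapping.keys (v $ a))"

text \<open>Side length \<open>L\<close> is measured between the extreme sites, so a single site has side length \<open>0\<close>.\<close>

definition lattice_box :: "int ^ ('d::finite) \<Rightarrow> real \<Rightarrow> (int ^ 'd) set" where
  "lattice_box p L = {u. \<forall>i. p $ i \<le> u $ i \<and> real_of_int (u $ i) \<le> real_of_int (p $ i) + L}"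


section \<open>Translation-invariant stabilizer codes\<close>

text \<open>
  Finitely supported Paulis modulo phases; index \<open>Inl k\<close> is the X-part and \<open>Inr k\<close> the Z-part
  on the \<open>k\<close>-th qubit of a unit cell.
\<close>

type_synonym ('d, 'q) pauli = "'d laurent ^ ('q + 'q)"

text \<open>\<open>0\<close> if the two Paulis commute, \<open>1\<close> if they anticommute.\<close>

definition commutator :: "('d::finite, 'q::finite) pauli \<Rightarrow> ('d, 'q) pauli \<Rightarrow> bit" where
  "commutator P Q = (\<Sum>k\<in>UNIV.
     (\<Sum>u\<in>Poly_Mapping.keys (P $ Inl k).
        Poly_Mapping.lookup (P $ Inl k) u * Poly_Mapping.lookup (Q $ Inr k) u) +
     (\<Sum>u\<in>Poly_Mapping.keys (P $ Inr k).
        Poly_Mapping.lookup (P $ Inr k) u * Poly_Mapping.lookup (Q $ Inl k) u))"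

text \<open>
  The \<open>R\<close>-valued symplectic form \<open>P\<^sup>\<dagger> \<lambda> Q\<close>; by \<open>lookup_symplectic\<close> below its coefficient at
  \<open>x\<^sup>u\<close> is the commutator of \<open>Q\<close> with the translate of \<open>P\<close> by \<open>u\<close>.
\<close>

definition symplectic :: "('d::finite, 'q::finite) pauli \<Rightarrow> ('d, 'q) pauli \<Rightarrow> 'd laurent" where
  "symplectic P Q = (\<Sum>k\<in>UNIV.
     antipode (P $ Inl k) * Q $ Inr k + antipode (P $ Inr k) * Q $ Inl k)"

text \<open>
  A code is given by its generators \<open>\<sigma> $ a\<close> (all other generators are their translates
  \<open>xpow u *s \<sigma> $ a\<close>), which must all commute with one another.
\<close>

definition stabilizer_code :: "('d::finite, 'q::finite) pauli ^ 'm \<Rightarrow> bool" where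
  "stabilizer_code \<sigma> \<longleftrightarrow> (\<forall>a b. symplectic (\<sigma> $ a) (\<sigma> $ b) = 0)"

definition excitation ::
    "('d::finite, 'q::finite) pauli ^ 'm \<Rightarrow> ('d, 'q) pauli \<Rightarrow> 'd laurent ^ 'm" where
  "excitation \<sigma> P = (\<chi> a. symplectic (\<sigma> $ a) P)"

definition eps_plus ::
    "('d::finite, 'q::finite) pauli ^ 'm \<Rightarrow> ('d laurent ^ 'm) set" where
  "eps_plus \<sigma> = range (excitation \<sigma>) \<inter> {f. \<forall>u\<in>sites f. \<forall>i. 0 \<le> u $ i}"

lemma lookup_antipode: "Poly_Mapping.lookup (antipode p) u = Poly_Mapping.lookup p (- u)"
  by (simp add: antipode_def map_key.rep_eq)

lemma Sum_any_lookup_when: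
  "(\<Sum>q. Poly_Mapping.lookup p q when (v :: int ^ 'd::finite) = u + q) = Poly_Mapping.lookup p (v - u)"
proof -
  have "(v = u + q) = (q = v - u)" for q
    by (metis add_diff_cancel_left' diff_add_cancel add.commute)
  then show ?thesis by simp
qed

lemma lookup_xpow_mult:
  "Poly_Mapping.lookup (xpow u * p) v = Poly_Mapping.lookup p (v - u)"
proof -
  have "Poly_Mapping.lookup (xpow u) l * c = (c when l = u)" for l and c :: bit
    by (cases "l = u") (simp_all add: xpow_def lookup_single)
  then have "Poly_Mapping.lookup (xpow u * p) v =
      (\<Sum>l. (\<Sum>q. Poly_Mapping.lookup p q when v = l + q) when l = u)"
    by (simp only: lookup_mult)
  then show ?thesis by (simp add: Sum_any_lookup_when)
qed

lemma lookup_antipode_mult: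
  "Poly_Mapping.lookup (antipode p * r) u =
   (\<Sum>v\<in>Poly_Mapping.keys (xpow u * p).
      Poly_Mapping.lookup (xpow u * p) v * Poly_Mapping.lookup r v)"
proof -
  have "Poly_Mapping.lookup (antipode p * r) u =
      (\<Sum>l. Poly_Mapping.lookup p (- l) * Poly_Mapping.lookup r (u - l))"
    by (simp add: lookup_mult Sum_any_lookup_when lookup_antipode)
  also have "\<dots> = (\<Sum>v. Poly_Mapping.lookup p (v - u) * Poly_Mapping.lookup r v)"
  proof (rule Sum_any.reindex_cong)
    show "bij (\<lambda>v. u - v)" by (rule o_bij[where g = "\<lambda>v. u - v"]) (simp_all add: fun_eq_iff)
  qed (simp add: o_def)
  also have "\<dots> = (\<Sum>v. Poly_Mapping.lookup (xpow u * p) v * Poly_Mapping.lookup r v)"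
    by (simp add: lookup_xpow_mult)
  also have "\<dots> = (\<Sum>v\<in>Poly_Mapping.keys (xpow u * p).
      Poly_Mapping.lookup (xpow u * p) v * Poly_Mapping.lookup r v)"
    by (intro Sum_any.expand_superset) (auto simp: in_keys_iff)
  finally show ?thesis .
qed

lemma lookup_symplectic:
  "Poly_Mapping.lookup (symplectic P Q) u = commutator (xpow u *s P) Q"
  by (simp add: symplectic_def commutator_def lookup_sum lookup_add lookup_antipode_mult)

lemma stabilizer_code_iff_commute:
  "stabilizer_code \<sigma> \<longleftrightarrow> (\<forall>a b u v. commutator (xpow u *s \<sigma> $ a) (xpow v *s \<sigma> $ b) = 0)"
proof -
  have shift: "symplectic P (xpow v *s Q) = xpow v * symplectic P Q"
    for P Q :: "('a, 'b) pauli" and v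
    by (simp add: symplectic_def sum_distrib_left algebra_simps)
  have one: "xpow 0 * p = p" for p :: "'a laurent"
    by (rule poly_mapping_eqI) (simp add: lookup_xpow_mult)
  show ?thesis
  proof
    assume "stabilizer_code \<sigma>"
    then show "\<forall>a b u v. commutator (xpow u *s \<sigma> $ a) (xpow v *s \<sigma> $ b) = 0"
      by (simp add: stabilizer_code_def shift flip: lookup_symplectic)
  next
    assume *: "\<forall>a b u v. commutator (xpow u *s \<sigma> $ a) (xpow v *s \<sigma> $ b) = 0"
    have "Poly_Mapping.lookup (symplectic (\<sigma> $ a) (xpow 0 *s \<sigma> $ b)) u = 0" for a b u
      using * by (simp only: lookup_symplectic)
    then show "stabilizer_code \<sigma>"
      by (simp add: stabilizer_code_def shift one poly_mapping_eq_iff fun_eq_iff)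
  qed
qed

lemma excitation_add: "excitation \<sigma> (P + Q) = excitation \<sigma> P + excitation \<sigma> Q"
  by (simp add: excitation_def symplectic_def vec_eq_iff sum.distrib algebra_simps)

lemma excitation_scale: "excitation \<sigma> (r *s P) = r *s excitation \<sigma> P"
  by (simp add: excitation_def symplectic_def vec_eq_iff sum_distrib_left algebra_simps)


section \<open>Term order and Groebner bases\<close>

text \<open>Positivity, and linear independence over the rationals of the family \<open>1, \<omega>\<^sub>1, \<dots>, \<omega>\<^sub>D\<close>.\<close>

definition admissible_weights :: "real ^ ('d::finite) \<Rightarrow> bool" where
  "admissible_weights \<omega> \<longleftrightarrow>
     (\<forall>i. 0 < \<omega> $ i) \<and>
     (\<forall>(c0::rat) (c::'d \<Rightarrow> rat).
        of_rat c0 + (\<Sum>i\<in>UNIV. of_rat (c i) * \<omega> $ i) = 0 \<longrightarrow> c0 = 0 \<and> (\<forall>i. c i = 0))"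

definition admissible_shifts :: "('m \<Rightarrow> nat) \<Rightarrow> bool" where
  "admissible_shifts \<eta> \<longleftrightarrow> inj \<eta> \<and> (\<forall>a. 0 < \<eta> a)"

definition Phi :: "real ^ ('d::finite) \<Rightarrow> ('m \<Rightarrow> nat) \<Rightarrow> (int ^ 'd) \<times> 'm \<Rightarrow> real" where
  "Phi \<omega> \<eta> = (\<lambda>(u, a). (\<Sum>i\<in>UNIV. \<omega> $ i * real_of_int (u $ i)) + real (\<eta> a))"

text \<open>Only meaningful for \<open>f \<noteq> 0\<close>; \<open>Phi\<close> is injective for admissible weights and shifts.\<close>

definition LT :: "real ^ ('d::finite) \<Rightarrow> ('m \<Rightarrow> nat) \<Rightarrow> 'd laurent ^ 'm \<Rightarrow> (int ^ 'd) \<times> 'm" where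
  "LT \<omega> \<eta> f = arg_max_on (Phi \<omega> \<eta>) (msupp f)"

definition mdvd :: "(int ^ ('d::finite)) \<times> 'm \<Rightarrow> (int ^ 'd) \<times> 'm \<Rightarrow> bool" where
  "mdvd = (\<lambda>(v, b) (u, a). a = b \<and> (\<forall>i. v $ i \<le> u $ i))"

text \<open>As usual the elements of a Groebner basis are nonzero, so that they have leading terms.\<close>

definition groebner_basis ::
    "real ^ ('d::finite) \<Rightarrow> ('m \<Rightarrow> nat) \<Rightarrow> ('d laurent ^ 'm) set \<Rightarrow> ('d laurent ^ 'm) set \<Rightarrow> bool" where
  "groebner_basis \<omega> \<eta> M G \<longleftrightarrow>
     finite G \<and> G \<subseteq> M \<and> 0 \<notin> G \<and>
     (\<forall>f\<in>M. f \<noteq> 0 \<longrightarrow> (\<exists>g\<in>G. mdvd (LT \<omega> \<eta> g) (LT \<omega> \<eta> f)))"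


section \<open>The parallelized division process\<close>

text \<open>The list \<open>gs\<close> enumerates the Groebner basis by decreasing priority.\<close>

definition triggered ::
    "real ^ ('d::finite) \<Rightarrow> ('m \<Rightarrow> nat) \<Rightarrow> ('d laurent ^ 'm) list \<Rightarrow> (int ^ 'd) \<times> 'm
      \<Rightarrow> ('d laurent ^ 'm) option" where
  "triggered \<omega> \<eta> gs \<mu> = find (\<lambda>g. mdvd (LT \<omega> \<eta> g) \<mu>) gs"

text \<open>
  The sum over the current syndrome \<open>s\<close> of the triggered multiples of \<open>r g\<close>, where \<open>r g = g\<close>
  for the syndrome update and \<open>r g\<close> is the Pauli lift of \<open>g\<close> for the correction update.
\<close>

definition total_move ::
    "real ^ ('d::finite) \<Rightarrow> ('m \<Rightarrow> nat) \<Rightarrow> ('d laurent ^ 'm) list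
      \<Rightarrow> ('d laurent ^ 'm \<Rightarrow> 'd laurent ^ 'n) \<Rightarrow> 'd laurent ^ 'm \<Rightarrow> 'd laurent ^ 'n" where
  "total_move \<omega> \<eta> gs r s = (\<Sum>\<mu>\<in>msupp s.
     case triggered \<omega> \<eta> gs \<mu> of
       None \<Rightarrow> 0
     | Some g \<Rightarrow> xpow (fst \<mu> - fst (LT \<omega> \<eta> g)) *s r g)"

definition division_round ::
    "real ^ ('d::finite) \<Rightarrow> ('m \<Rightarrow> nat) \<Rightarrow> ('d laurent ^ 'm \<Rightarrow> ('d, 'q::finite) pauli)
      \<Rightarrow> ('d laurent ^ 'm) list \<Rightarrow> ('d laurent ^ 'm) \<times> ('d, 'q) pauli
      \<Rightarrow> ('d laurent ^ 'm) \<times> ('d, 'q) pauli" where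
  "division_round \<omega> \<eta> h gs =
     (\<lambda>(s, c). (s + total_move \<omega> \<eta> gs (\<lambda>g. g) s, c + total_move \<omega> \<eta> gs h s))"

definition division_state ::
    "real ^ ('d::finite) \<Rightarrow> ('m \<Rightarrow> nat) \<Rightarrow> ('d laurent ^ 'm \<Rightarrow> ('d, 'q::finite) pauli)
      \<Rightarrow> ('d laurent ^ 'm) list \<Rightarrow> 'd laurent ^ 'm \<Rightarrow> nat
      \<Rightarrow> ('d laurent ^ 'm) \<times> ('d, 'q) pauli" where
  "division_state \<omega> \<eta> h gs f t = (division_round \<omega> \<eta> h gs ^^ t) (f, 0)"

definition syndrome_at where
  "syndrome_at \<omega> \<eta> h gs f t = fst (division_state \<omega> \<eta> h gs f t)"

definition correction_at where
  "correction_at \<omega> \<eta> h gs f t = snd (division_state \<omega> \<eta> h gs f t)"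

end

theory Submission
  imports Defs
begin

text \<open>
  Let \<open>\<delta>\<close> be a lower bound for the drop of \<open>\<Phi>\<close> from the leading monomial of an element of \<open>G\<close> to
  any other of its monomials. A divisible monomial does not survive a round unless some move
  started from another divisible monomial recreates it, and that one has a \<open>\<Phi>\<close>-value larger by at
  least \<open>\<delta>\<close>. Hence the monomials triggered in round \<open>t\<close> satisfy \<open>\<Phi> \<le> max \<Phi>(f) - t \<delta>\<close>, although
  idle monomials may keep the maximum of \<open>\<Phi>\<close> over the syndrome from dropping at this rate. As
  \<open>\<Phi> > 0\<close> on the positive orthant, nothing is triggered after \<open>max \<Phi>(f) / \<delta> = O(W)\<close> rounds, and a
  syndrome without divisible monomials vanishes. Moreover \<open>\<Phi>\<close> never exceeds \<open>max \<Phi>(f) = O(W)\<close>,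
  which bounds all coordinates because the weights are positive.
\<close>

section \<open>Module monomials and leading terms\<close>

lemma mem_msupp: "(u, a) \<in> msupp v \<longleftrightarrow> Poly_Mapping.lookup (v $ a) u \<noteq> 0"
  by (simp add: msupp_def in_keys_iff)

lemma finite_msupp: "finite (msupp (v :: ('d::finite) laurent ^ ('n::finite)))"
proof -
  have "msupp v = (\<Union>a. (\<lambda>u. (u, a)) ` Poly_Mapping.keys (v $ a))"
    by (auto simp: msupp_def)
  then show ?thesis by simp
qed

lemma msupp_eq_empty_iff: "msupp v = {} \<longleftrightarrow> v = 0"
proof
  assume empty: "msupp v = {}"
  have "v $ a = 0" for a
    using empty mem_msupp[of _ a v] by (intro poly_mapping_eqI) simp
  then show "v = 0" by (simp add: vec_eq_iff)
qed (simp add: msupp_def)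

lemma mem_sites: "u \<in> sites v \<longleftrightarrow> (\<exists>a. (u, a) \<in> msupp v)"
  by (simp add: sites_def msupp_def)

lemma msupp_add: "msupp (v + w) \<subseteq> msupp v \<union> msupp w"
  by (auto simp: mem_msupp lookup_add)

lemma msupp_sum: "msupp (\<Sum>x\<in>A. v x) \<subseteq> (\<Union>x\<in>A. msupp (v x))"
proof (induction A rule: infinite_finite_induct)
  case (insert x A)
  then show ?case using msupp_add[of "v x" "sum v A"] by auto
qed (auto simp: mem_msupp)

lemma msupp_shift: "(u, a) \<in> msupp (xpow w *s v) \<longleftrightarrow> (u - w, a) \<in> msupp v"
  by (simp add: mem_msupp lookup_xpow_mult)

section \<open>The weight function as a term order\<close>

lemma Phi_shift:
  "Phi \<omega> \<eta> (u, a) = Phi \<omega> \<eta> (u - w, a) + (\<Sum>i\<in>UNIV. \<omega> $ i * real_of_int (w $ i))"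
  by (simp add: Phi_def right_diff_distrib sum_subtractf)

text \<open>Equal values give an integer relation between 1 and the weights, so rational
  independence makes every coefficient vanish: the constant one yields equal shifts, the others
  equal exponents. Injectivity is what turns maximality of a leading monomial into strict
  maximality.\<close>

lemma inj_Phi:
  assumes "admissible_weights \<omega>" "admissible_shifts \<eta>"
  shows "inj (Phi \<omega> \<eta>)"
proof (rule injI, clarify)
  fix u a v b
  assume eq: "Phi \<omega> \<eta> (u, a) = Phi \<omega> \<eta> (v, b)"
  define c0 where "c0 = (of_int (int (\<eta> a) - int (\<eta> b)) :: rat)"
  define c where "c i = (of_int (u $ i - v $ i) :: rat)" for i
  have "of_rat c0 + (\<Sum>i\<in>UNIV. of_rat (c i) * \<omega> $ i) = 0"
    using eq by (simp add: c0_def c_def Phi_def of_rat_diff left_diff_distrib right_diff_distrib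
        sum_subtractf mult.commute)
  then have "c0 = 0" "c i = 0" for i
    using assms(1) unfolding admissible_weights_def by blast+
  then have "\<eta> a = \<eta> b" "u $ i = v $ i" for i
    unfolding c0_def c_def by simp_all
  then show "u = v \<and> a = b"
    using assms(2) by (auto simp: admissible_shifts_def vec_eq_iff dest: injD)
qed

text \<open>\<open>LT\<close> is a choice among maximisers; the support of a nonzero
  \<open>f\<close> is finite and nonempty, so there is one to choose.\<close>

lemma LT_is_arg_max:
  fixes f :: "('d::finite) laurent ^ ('m::finite)"
  assumes "f \<noteq> 0"
  shows "is_arg_max (Phi \<omega> \<eta>) (\<lambda>\<mu>. \<mu> \<in> msupp f) (LT \<omega> \<eta> f)"
proof -
  have ne: "msupp f \<noteq> {}" using assms by (simp add: msupp_eq_empty_iff)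
  have "Max (Phi \<omega> \<eta> ` msupp f) \<in> Phi \<omega> \<eta> ` msupp f"
    using ne by (intro Max_in) (auto simp: finite_msupp)
  then obtain \<mu> where "\<mu> \<in> msupp f" "Phi \<omega> \<eta> \<mu> = Max (Phi \<omega> \<eta> ` msupp f)" by auto
  then have "is_arg_max (Phi \<omega> \<eta>) (\<lambda>\<mu>. \<mu> \<in> msupp f) \<mu>"
    by (simp add: is_arg_max_linorder finite_msupp)
  then show ?thesis unfolding LT_def arg_max_on_def arg_max_def by (rule someI)
qed

lemma LT_in_msupp:
  fixes f :: "('d::finite) laurent ^ ('m::finite)"
  shows "f \<noteq> 0 \<Longrightarrow> LT \<omega> \<eta> f \<in> msupp f"
  using LT_is_arg_max[of f \<omega> \<eta>] by (simp add: is_arg_max_def)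

lemma Phi_le_LT:
  fixes f :: "('d::finite) laurent ^ ('m::finite)"
  assumes "\<mu> \<in> msupp f"
  shows "Phi \<omega> \<eta> \<mu> \<le> Phi \<omega> \<eta> (LT \<omega> \<eta> f)"
proof -
  have "f \<noteq> 0" using assms msupp_eq_empty_iff[of f] by blast
  then show ?thesis using LT_is_arg_max[of f \<omega> \<eta>] assms by (cases \<mu>) (simp add: is_arg_max_linorder)
qed

text \<open>Only finitely many drops occur, and each is strictly positive by injectivity, so their
  minimum is a common \<delta>.\<close>

lemma ex_Phi_gap:
  fixes G :: "(('d::finite) laurent ^ ('m::finite)) set"
  assumes inj: "inj (Phi \<omega> \<eta>)" and "finite G"
  obtains \<delta> where "\<delta> > 0"
    and "\<And>g \<nu>. g \<in> G \<Longrightarrow> \<nu> \<in> msupp g \<Longrightarrow> \<nu> \<noteq> LT \<omega> \<eta> g \<Longrightarrow> Phi \<omega> \<eta> \<nu> \<le> Phi \<omega> \<eta> (LT \<omega> \<eta> g) - \<delta>"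
proof -
  define A where "A = (\<Union>g\<in>G. (\<lambda>\<nu>. Phi \<omega> \<eta> (LT \<omega> \<eta> g) - Phi \<omega> \<eta> \<nu>) ` (msupp g - {LT \<omega> \<eta> g}))"
  have fin: "finite (insert 1 A)" using assms(2) by (simp add: A_def finite_msupp)
  have pos: "0 < x" if x: "x \<in> A" for x
  proof -
    obtain g \<nu> where "\<nu> \<in> msupp g" "\<nu> \<noteq> LT \<omega> \<eta> g" "x = Phi \<omega> \<eta> (LT \<omega> \<eta> g) - Phi \<omega> \<eta> \<nu>"
      using x unfolding A_def by blast
    then show ?thesis using Phi_le_LT[of \<nu> g \<omega> \<eta>] injD[OF inj, of \<nu> "LT \<omega> \<eta> g"] by fastforce
  qed
  show thesis
  \<comment> \<open>The extra 1 keeps the minimum meaningful when \<open>A\<close> is empty, that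
    is, when \<open>G\<close> is empty or consists of monomials.\<close>
  proof (rule that[of "Min (insert 1 A)"])
    show "0 < Min (insert 1 A)" using fin pos by (subst Min_gr_iff) auto
  next
    fix g \<nu> assume "g \<in> G" "\<nu> \<in> msupp g" "\<nu> \<noteq> LT \<omega> \<eta> g"
    then have "Phi \<omega> \<eta> (LT \<omega> \<eta> g) - Phi \<omega> \<eta> \<nu> \<in> insert 1 A" by (auto simp: A_def)
    then show "Phi \<omega> \<eta> \<nu> \<le> Phi \<omega> \<eta> (LT \<omega> \<eta> g) - Min (insert 1 A)"
      using Min_le[OF fin] by fastforce
  qed
qed

section \<open>Closure properties of \<open>eps_plus\<close>\<close>

lemma zero_in_range_excitation: "0 \<in> range (excitation \<sigma>)"
  using excitation_scale[of \<sigma> 0 0] by (metis rangeI vector_smult_lzero)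

lemma add_in_eps_plus: "v \<in> eps_plus \<sigma> \<Longrightarrow> w \<in> eps_plus \<sigma> \<Longrightarrow> v + w \<in> eps_plus \<sigma>"
proof -
  assume vw: "v \<in> eps_plus \<sigma>" "w \<in> eps_plus \<sigma>"
  then obtain P Q where "v = excitation \<sigma> P" "w = excitation \<sigma> Q"
    by (auto simp: eps_plus_def)
  then have "v + w \<in> range (excitation \<sigma>)"
    by (metis excitation_add rangeI)
  moreover have "sites (v + w) \<subseteq> sites v \<union> sites w"
    using msupp_add[of v w] by (fastforce simp: mem_sites)
  ultimately show ?thesis using vw by (auto simp: eps_plus_def)
qed

lemma zero_in_eps_plus: "0 \<in> eps_plus \<sigma>"
  using zero_in_range_excitation[of \<sigma>] by (auto simp: eps_plus_def mem_sites mem_msupp)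

lemma sum_in_eps_plus: "(\<And>x. x \<in> A \<Longrightarrow> v x \<in> eps_plus \<sigma>) \<Longrightarrow> (\<Sum>x\<in>A. v x) \<in> eps_plus \<sigma>"
  by (induction A rule: infinite_finite_induct) (simp_all add: zero_in_eps_plus add_in_eps_plus)

lemma shift_in_eps_plus:
  assumes "v \<in> eps_plus \<sigma>" "\<And>i. 0 \<le> w $ i"
  shows "xpow w *s v \<in> eps_plus \<sigma>"
proof -
  have "xpow w *s v \<in> range (excitation \<sigma>)"
    using assms(1) by (auto simp: eps_plus_def simp flip: excitation_scale)
  moreover have "0 \<le> u $ i" if "u \<in> sites (xpow w *s v)" for u i
  proof -
    have "u - w \<in> sites v" using that by (auto simp: mem_sites msupp_shift)
    then have "0 \<le> (u - w) $ i" using assms(1) unfolding eps_plus_def by blast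
    then show ?thesis using assms(2)[of i] by simp
  qed
  ultimately show ?thesis by (simp add: eps_plus_def)
qed


section \<open>The division process\<close>

lemma triggered_SomeD:
  "triggered \<omega> \<eta> gs \<mu> = Some g \<Longrightarrow> g \<in> set gs \<and> mdvd (LT \<omega> \<eta> g) \<mu>"
  by (auto simp: triggered_def find_Some_iff)

lemma msupp_total_moveE:
  assumes "\<nu> \<in> msupp (total_move \<omega> \<eta> gs r s)"
  obtains \<mu> g where "\<mu> \<in> msupp s" "triggered \<omega> \<eta> gs \<mu> = Some g"
    "\<nu> \<in> msupp (xpow (fst \<mu> - fst (LT \<omega> \<eta> g)) *s r g)"
proof -
  obtain \<mu> where \<mu>: "\<mu> \<in> msupp s" "\<nu> \<in> msupp (case triggered \<omega> \<eta> gs \<mu> of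
      None \<Rightarrow> 0 | Some g \<Rightarrow> xpow (fst \<mu> - fst (LT \<omega> \<eta> g)) *s r g)"
    using assms subsetD[OF msupp_sum] unfolding total_move_def by blast
  show thesis
  proof (cases "triggered \<omega> \<eta> gs \<mu>")
    case None
    then show ?thesis using \<mu>(2) by (auto simp: msupp_def)
  qed (use \<mu> that in simp)
qed

text \<open>The gap \<delta> is a parameter because it can be chosen from the basis alone. It is
  thus fixed before the priority order and the initial syndrome, and the resulting bounds are
  uniform in both.\<close>

locale parallel_division =
  fixes \<sigma> :: "('d::finite, 'q::finite) pauli ^ ('m::finite)"
    and \<omega> :: "real ^ 'd"
    and \<eta> :: "'m \<Rightarrow> nat"
    and gs :: "('d laurent ^ 'm) list"
    and h :: "'d laurent ^ 'm \<Rightarrow> ('d, 'q) pauli"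
    and \<delta> :: real
  assumes weights_pos: "\<And>i. 0 < \<omega> $ i"
    and shifts_pos: "\<And>a. 0 < \<eta> a"
    and groebner: "groebner_basis \<omega> \<eta> (eps_plus \<sigma>) (set gs)"
    and gap_pos: "0 < \<delta>"
    and gap: "\<And>g \<nu>. g \<in> set gs \<Longrightarrow> \<nu> \<in> msupp g \<Longrightarrow> \<nu> \<noteq> LT \<omega> \<eta> g \<Longrightarrow>
      Phi \<omega> \<eta> \<nu> \<le> Phi \<omega> \<eta> (LT \<omega> \<eta> g) - \<delta>"
begin

section \<open>A single round\<close>

abbreviation "\<Phi> \<equiv> Phi \<omega> \<eta>"
abbreviation "trig \<equiv> triggered \<omega> \<eta> gs"
abbreviation "move g \<mu> \<equiv> xpow (fst \<mu> - fst (LT \<omega> \<eta> g)) *s g"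

lemma basis_in_eps_plus: "g \<in> set gs \<Longrightarrow> g \<in> eps_plus \<sigma>"
  and basis_nonzero: "g \<in> set gs \<Longrightarrow> g \<noteq> 0"
  using groebner by (auto simp: groebner_basis_def)

text \<open>The shift carries the leading monomial of \<open>g\<close> exactly onto \<mu>, so over
  the two-element field the move flips \<mu> itself.\<close>

lemma start_in_move:
  assumes "trig \<mu> = Some g"
  shows "\<mu> \<in> msupp (move g \<mu>)"
proof -
  obtain u a where \<mu>: "\<mu> = (u, a)" by force
  have "snd (LT \<omega> \<eta> g) = a"
    using triggered_SomeD[OF assms] by (auto simp: mdvd_def \<mu> split: prod.splits)
  moreover have "LT \<omega> \<eta> g \<in> msupp g"
    using triggered_SomeD[OF assms] basis_nonzero LT_in_msupp by blast
  ultimately show ?thesis by (cases "LT \<omega> \<eta> g") (simp add: \<mu> msupp_shift)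
qed

text \<open>A translation changes all \<Phi>-values by the same amount, so the gap inside
  \<open>g\<close> survives in each of its translates.\<close>

lemma Phi_move:
  assumes "trig \<mu> = Some g" "\<nu> \<in> msupp (move g \<mu>)" "\<nu> \<noteq> \<mu>"
  shows "\<Phi> \<nu> \<le> \<Phi> \<mu> - \<delta>"
proof -
  obtain u a v b l where eqs: "\<mu> = (u, a)" "\<nu> = (v, b)" "LT \<omega> \<eta> g = (l, a)"
    using triggered_SomeD[OF assms(1)]
    by (cases \<mu>; cases \<nu>; cases "LT \<omega> \<eta> g") (auto simp: mdvd_def)
  have "(v - (u - l), b) \<in> msupp g"
    using assms(2) by (simp add: eqs msupp_shift)
  moreover have "(v - (u - l), b) \<noteq> LT \<omega> \<eta> g"
    using assms(3) by (auto simp: eqs algebra_simps)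
  ultimately have "\<Phi> (v - (u - l), b) \<le> \<Phi> (l, a) - \<delta>"
    using gap triggered_SomeD[OF assms(1)] eqs(3) by metis
  then show ?thesis
    using Phi_shift[of \<omega> \<eta> v b "u - l"] Phi_shift[of \<omega> \<eta> u a "u - l"] by (simp add: eqs)
qed

lemma Phi_move_le:
  assumes "trig \<mu> = Some g" "\<nu> \<in> msupp (move g \<mu>)"
  shows "\<Phi> \<nu> \<le> \<Phi> \<mu>"
  using Phi_move[OF assms] gap_pos by (cases "\<nu> = \<mu>") auto

text \<open>Strictness comes from the shift \<eta>; it rules out triggers as soon as their upper
  bound reaches 0.\<close>

lemma Phi_pos:
  assumes "s \<in> eps_plus \<sigma>" "\<mu> \<in> msupp s"
  shows "0 < \<Phi> \<mu>"
proof -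
  obtain u a where \<mu>: "\<mu> = (u, a)" by force
  have "0 \<le> u $ i" for i
    using assms by (auto simp: eps_plus_def mem_sites \<mu>)
  then have "0 \<le> (\<Sum>i\<in>UNIV. \<omega> $ i * real_of_int (u $ i))"
    using weights_pos by (intro sum_nonneg mult_nonneg_nonneg) (auto simp: less_imp_le)
  then show ?thesis using shifts_pos[of a] by (simp add: \<mu> Phi_def)
qed

text \<open>Divisibility makes the shift of each triggered move nonnegative, so no move leaves the
  positive orthant.\<close>

lemma total_move_in_eps_plus:
  "s \<in> eps_plus \<sigma> \<Longrightarrow> total_move \<omega> \<eta> gs (\<lambda>g. g) s \<in> eps_plus \<sigma>"
  unfolding total_move_def
proof (intro sum_in_eps_plus)
  fix \<mu>
  have "move g \<mu> \<in> eps_plus \<sigma>" if "trig \<mu> = Some g" for g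
  proof (rule shift_in_eps_plus)
    show "g \<in> eps_plus \<sigma>" using that triggered_SomeD basis_in_eps_plus by blast
    show "0 \<le> (fst \<mu> - fst (LT \<omega> \<eta> g)) $ i" for i
      using triggered_SomeD[OF that] by (auto simp: mdvd_def split: prod.splits)
  qed
  then show "(case trig \<mu> of None \<Rightarrow> 0 | Some g \<Rightarrow> move g \<mu>) \<in> eps_plus \<sigma>"
    by (simp add: zero_in_eps_plus split: option.splits)
qed

text \<open>Without such a \<mu>, the only move that can touch \<nu> is the one started at \<nu>. It
  occurs precisely when \<nu> is in \<open>s\<close>, and then removes it; so \<nu> is absent after
  the round in either case.\<close>

lemma retriggered:
  assumes "\<nu> \<in> msupp (s + total_move \<omega> \<eta> gs (\<lambda>g. g) s)" "trig \<nu> \<noteq> None"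
  shows "\<exists>\<mu>\<in>msupp s. trig \<mu> \<noteq> None \<and> \<Phi> \<nu> \<le> \<Phi> \<mu> - \<delta>"
proof (rule ccontr)
  assume no: "\<not> ?thesis"
  obtain u a where \<nu>: "\<nu> = (u, a)" by force
  define c where "c v = Poly_Mapping.lookup (v $ a) u" for v :: "'d laurent ^ 'm"
  define m where "m \<mu> = (case trig \<mu> of None \<Rightarrow> 0 | Some g \<Rightarrow> move g \<mu>)" for \<mu>
  have c_iff: "c v \<noteq> 0 \<longleftrightarrow> \<nu> \<in> msupp v" for v
    by (simp add: c_def \<nu> mem_msupp)
  have c_add: "c (v + w) = c v + c w" for v w
    by (simp add: c_def lookup_add)
  have c_sum: "c (\<Sum>\<mu>\<in>msupp s. m \<mu>) = (\<Sum>\<mu>\<in>msupp s. c (m \<mu>))"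
    by (simp add: c_def lookup_sum)
  \<comment> \<open>A triggered \<mu> whose move reaches \<nu> would be the witness excluded by
    \<open>no\<close>, by \<open>Phi_move\<close>.\<close>
  have other: "c (m \<mu>) = 0" if "\<mu> \<in> msupp s" "\<mu> \<noteq> \<nu>" for \<mu>
  proof (cases "trig \<mu>")
    case (Some g)
    then have "\<nu> \<notin> msupp (move g \<mu>)"
      using no that Phi_move[of \<mu> g \<nu>] by auto
    then show ?thesis using c_iff[of "move g \<mu>"] Some by (simp add: m_def)
  qed (simp add: m_def c_def)
  have "c (\<Sum>\<mu>\<in>msupp s. m \<mu>) = (\<Sum>\<mu>\<in>msupp s. if \<mu> = \<nu> then c (m \<nu>) else 0)"
    unfolding c_sum using other by (intro sum.cong) auto
  also have "\<dots> = (if \<nu> \<in> msupp s then c (m \<nu>) else 0)"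
    by (simp add: finite_msupp)
  \<comment> \<open>Triggering depends on \<nu> alone, so \<open>m \<nu>\<close> has coefficient 1
    at \<nu> whether or not \<nu> lies in \<open>s\<close>; the guard then reproduces the
    coefficient of \<nu> in \<open>s\<close>.\<close>
  also have "\<dots> = c s"
  proof -
    obtain g where "trig \<nu> = Some g" using assms(2) by auto
    then have "c (m \<nu>) = 1" using start_in_move[of \<nu> g] c_iff[of "move g \<nu>"] by (simp add: m_def)
    moreover have "c s = (if \<nu> \<in> msupp s then 1 else 0)" using c_iff[of s] by auto
    ultimately show ?thesis by simp
  qed
  \<comment> \<open>Two equal coefficients add up to 0 in characteristic two.\<close>
  finally have "c (s + total_move \<omega> \<eta> gs (\<lambda>g. g) s) = 0"
    by (simp add: c_add total_move_def m_def)
  then show False using assms(1) c_iff[of "s + total_move \<omega> \<eta> gs (\<lambda>g. g) s"] by simp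
qed

text \<open>This is where the Groebner property enters: the leading monomial of a nonzero syndrome
  would be divisible, hence triggered.\<close>

lemma untriggered_eq_0:
  assumes "s \<in> eps_plus \<sigma>" "\<And>\<mu>. \<mu> \<in> msupp s \<Longrightarrow> trig \<mu> = None"
  shows "s = 0"
proof (rule ccontr)
  assume "s \<noteq> 0"
  then obtain g where "g \<in> set gs" "mdvd (LT \<omega> \<eta> g) (LT \<omega> \<eta> s)"
    using groebner assms(1) by (auto simp: groebner_basis_def)
  then have "trig (LT \<omega> \<eta> s) \<noteq> None" unfolding triggered_def find_None_iff by blast
  then show False using assms(2)[OF LT_in_msupp[OF \<open>s \<noteq> 0\<close>]] by simp
qed

section \<open>Bounds along a whole run\<close>

context
  fixes f :: "'d laurent ^ 'm" and M :: real
  assumes start: "f \<in> eps_plus \<sigma>" and Phi_start: "\<And>\<mu>. \<mu> \<in> msupp f \<Longrightarrow> \<Phi> \<mu> \<le> M"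
begin

abbreviation "syn \<equiv> syndrome_at \<omega> \<eta> h gs f"
abbreviation "cor \<equiv> correction_at \<omega> \<eta> h gs f"

lemma syn_0: "syn 0 = f"
  and cor_0: "cor 0 = 0"
  and syn_Suc: "syn (Suc t) = syn t + total_move \<omega> \<eta> gs (\<lambda>g. g) (syn t)"
  and cor_Suc: "cor (Suc t) = cor t + total_move \<omega> \<eta> gs h (syn t)"
  by (simp_all add: syndrome_at_def correction_at_def division_state_def division_round_def
      split: prod.splits)

lemma syn_in_eps_plus: "syn t \<in> eps_plus \<sigma>"
  by (induction t) (simp_all add: syn_0 start syn_Suc add_in_eps_plus total_move_in_eps_plus)

lemma Phi_syn_le: "\<mu> \<in> msupp (syn t) \<Longrightarrow> \<Phi> \<mu> \<le> M"
proof (induction t arbitrary: \<mu>)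
  case 0
  then show ?case by (simp add: syn_0 Phi_start)
next
  case (Suc t)
  then consider "\<mu> \<in> msupp (syn t)" | "\<mu> \<in> msupp (total_move \<omega> \<eta> gs (\<lambda>g. g) (syn t))"
    using msupp_add[of "syn t"] unfolding syn_Suc by blast
  then show ?case
  proof cases
    case 2
    then obtain \<mu>' g where "\<mu>' \<in> msupp (syn t)" "trig \<mu>' = Some g" "\<mu> \<in> msupp (move g \<mu>')"
      by (rule msupp_total_moveE)
    then show ?thesis using Suc.IH Phi_move_le by (blast intro: order_trans)
  qed (rule Suc.IH)
qed

text \<open>\<open>retriggered\<close> traces a trigger in round \<open>t\<close> back through a
  chain of triggers to \<open>f\<close>, losing \<delta> at each link.\<close>

lemma Phi_triggered_le: "\<mu> \<in> msupp (syn t) \<Longrightarrow> trig \<mu> \<noteq> None \<Longrightarrow> \<Phi> \<mu> \<le> M - real t * \<delta>"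
proof (induction t arbitrary: \<mu>)
  case 0
  then show ?case by (simp add: syn_0 Phi_start)
next
  case (Suc t)
  obtain \<mu>' where "\<mu>' \<in> msupp (syn t)" "trig \<mu>' \<noteq> None" "\<Phi> \<mu> \<le> \<Phi> \<mu>' - \<delta>"
    using Suc.prems retriggered[of \<mu> "syn t"] by (auto simp: syn_Suc)
  then show ?case using Suc.IH[of \<mu>'] by (simp add: algebra_simps)
qed

lemma syn_eventually_0:
  assumes "M \<le> real t * \<delta>"
  shows "syn t = 0"
proof (rule untriggered_eq_0[OF syn_in_eps_plus])
  fix \<mu> assume "\<mu> \<in> msupp (syn t)"
  then show "trig \<mu> = None"
    using Phi_triggered_le[of \<mu> t] Phi_pos[OF syn_in_eps_plus, of \<mu> t] assms by fastforce
qed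

text \<open>On the positive orthant all summands of \<Phi> are nonnegative, so each single term
  \<omega>_i u_i is at most \<open>M\<close>.\<close>

lemma sites_syn:
  assumes "u \<in> sites (syn t)"
  shows "0 \<le> u $ i" and "real_of_int (u $ i) \<le> M / \<omega> $ i"
proof -
  obtain a where a: "(u, a) \<in> msupp (syn t)" using assms by (auto simp: mem_sites)
  have nonneg: "0 \<le> u $ j" for j
    using syn_in_eps_plus[of t] assms by (simp add: eps_plus_def)
  then show "0 \<le> u $ i" .
  have "\<omega> $ i * real_of_int (u $ i) \<le> (\<Sum>j\<in>UNIV. \<omega> $ j * real_of_int (u $ j))"
    using nonneg weights_pos by (intro member_le_sum) (auto simp: less_imp_le)
  also have "\<dots> \<le> M" using Phi_syn_le[OF a] by (simp add: Phi_def)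
  finally show "real_of_int (u $ i) \<le> M / \<omega> $ i"
    using weights_pos[of i] by (simp add: field_simps)
qed

text \<open>A move at exponent \<open>u\<close> translates \<open>h g\<close> by
  \<open>u - l\<close>, where \<open>l\<close> is the leading exponent of \<open>g\<close>. Since 0
  \<le> l \<le> u coordinatewise, this translation is confined by the bounds on the syndrome, and
  \<open>h g\<close> itself adds at most \<open>K\<close> on either side. The bound is the same in
  every round, so accumulation does not enlarge the box.\<close>

lemma sites_cor:
  assumes "0 \<le> M" and K: "\<And>g w i. g \<in> set gs \<Longrightarrow> w \<in> sites (h g) \<Longrightarrow> \<bar>w $ i\<bar> \<le> K"
    and "v \<in> sites (cor t)"
  shows "- K \<le> v $ i \<and> real_of_int (v $ i) \<le> M / \<omega> $ i + real_of_int K"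
  using assms(3)
proof (induction t)
  case 0
  then show ?case by (simp add: cor_0 sites_def)
next
  case (Suc t)
  then consider "v \<in> sites (cor t)" | a where "(v, a) \<in> msupp (total_move \<omega> \<eta> gs h (syn t))"
    using msupp_add[of "cor t"] unfolding cor_Suc mem_sites by blast
  then show ?case
  proof cases
    case 2
    then obtain \<mu> g where \<mu>: "\<mu> \<in> msupp (syn t)" "trig \<mu> = Some g"
      and v: "(v, a) \<in> msupp (xpow (fst \<mu> - fst (LT \<omega> \<eta> g)) *s h g)"
      by (rule msupp_total_moveE)
    obtain u b l where eqs: "\<mu> = (u, b)" "LT \<omega> \<eta> g = (l, b)" and le: "l $ i \<le> u $ i"
      using triggered_SomeD[OF \<mu>(2)] by (cases \<mu>; cases "LT \<omega> \<eta> g") (auto simp: mdvd_def)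
    have g: "g \<in> set gs" using triggered_SomeD[OF \<mu>(2)] by simp
    have "l \<in> sites g"
      using LT_in_msupp[OF basis_nonzero[OF g], of \<omega> \<eta>] by (auto simp: mem_sites eqs)
    then have "0 \<le> l $ i"
      using basis_in_eps_plus[OF g] by (simp add: eps_plus_def)
    moreover have "real_of_int (u $ i) \<le> M / \<omega> $ i"
      using \<mu>(1) by (intro sites_syn) (auto simp: mem_sites eqs)
    moreover have "\<bar>(v - (u - l)) $ i\<bar> \<le> K"
      using v by (intro K[OF g]) (auto simp: mem_sites msupp_shift eqs)
    ultimately show ?thesis using le by simp linarith
  qed (rule Suc.IH)
qed

end

end

section \<open>Constants uniform in the box size, the syndrome and the priority order\<close>

theorem theorem9p3:
  fixes \<sigma> :: "('d::finite, 'q::finite) pauli ^ ('m::finite)"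
    and \<omega> :: "real ^ 'd"
    and \<eta> :: "'m \<Rightarrow> nat"
    and G :: "('d laurent ^ 'm) set"
    and h :: "'d laurent ^ 'm \<Rightarrow> ('d, 'q) pauli"
  assumes "stabilizer_code \<sigma>"
    and "admissible_weights \<omega>"
    and "admissible_shifts \<eta>"
    and "groebner_basis \<omega> \<eta> (eps_plus \<sigma>) G"
    and "\<And>g. g \<in> G \<Longrightarrow> excitation \<sigma> (h g) = g"
  shows "\<exists>C>0. \<forall>gs (W::real) f.
           distinct gs \<and> set gs = G \<and> 1 \<le> W \<and> f \<in> range (excitation \<sigma>) \<and> sites f \<subseteq> lattice_box 0 W \<longrightarrow>
             (\<exists>T::nat. real T \<le> C * W \<and> syndrome_at \<omega> \<eta> h gs f T = 0) \<and>
             (\<exists>p. \<forall>t. sites (syndrome_at \<omega> \<eta> h gs f t) \<subseteq> lattice_box p (C * W) \<and>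
                       sites (correction_at \<omega> \<eta> h gs f t) \<subseteq> lattice_box p (C * W))"
proof -
  have finG: "finite G" using assms(4) by (simp add: groebner_basis_def)
  obtain \<delta> where \<delta>: "\<delta> > 0" and gap: "\<And>g \<nu>. g \<in> G \<Longrightarrow> \<nu> \<in> msupp g \<Longrightarrow> \<nu> \<noteq> LT \<omega> \<eta> g \<Longrightarrow>
      Phi \<omega> \<eta> \<nu> \<le> Phi \<omega> \<eta> (LT \<omega> \<eta> g) - \<delta>"
    using ex_Phi_gap[OF inj_Phi[OF assms(2,3)] finG] by blast
  have wpos: "0 < \<omega> $ i" for i using assms(2) by (simp add: admissible_weights_def)
  \<comment> \<open>Chosen so that \<Phi> \<le> B W on the initial box; \<open>R\<close> bounds
    every 1/\<omega>_i, and \<open>K\<close> bounds all coordinates of all lifts. Sums replace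
    maxima, which also covers empty index sets.\<close>
  define B where "B = (\<Sum>i\<in>UNIV. \<omega> $ i) + (\<Sum>a\<in>UNIV. real (\<eta> a))"
  define R where "R = (\<Sum>i\<in>UNIV. 1 / \<omega> $ i)"
  define K where "K = (\<Sum>g\<in>G. \<Sum>w\<in>sites (h g). \<Sum>i\<in>UNIV. \<bar>w $ i\<bar>)"
  \<comment> \<open>The summands pay, in order, for the extent of the syndrome, the overhang of the
    lifts on both sides, the number of rounds, and the rounding up of that number.\<close>
  define C where "C = R * B + 2 * real_of_int K + B / \<delta> + 1"
  have B0: "0 \<le> B" unfolding B_def
    by (intro add_nonneg_nonneg sum_nonneg) (auto simp: wpos less_imp_le)
  have R0: "0 \<le> R" unfolding R_def by (intro sum_nonneg) (auto simp: wpos less_imp_le)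
  have K0: "0 \<le> K" unfolding K_def by (intro sum_nonneg) auto
  have C0: "0 < C" unfolding C_def using B0 R0 K0 \<delta> by (intro add_nonneg_pos add_nonneg_nonneg) auto
  have K: "\<bar>w $ i\<bar> \<le> K" if "g \<in> G" "w \<in> sites (h g)" for g w i
  proof -
    have "finite (sites (h g))" by (simp add: sites_def)
    then have "\<bar>w $ i\<bar> \<le> (\<Sum>w\<in>sites (h g). \<Sum>i\<in>UNIV. \<bar>w $ i\<bar>)"
      using that by (intro order_trans[OF member_le_sum[of i UNIV "\<lambda>i. \<bar>w $ i\<bar>"]]
          member_le_sum[of w _ "\<lambda>w. \<Sum>i\<in>UNIV. \<bar>w $ i\<bar>"]) (auto intro: sum_nonneg)
    also have "\<dots> \<le> K" unfolding K_def
      using that finG by (intro member_le_sum) (auto intro: sum_nonneg)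
    finally show ?thesis .
  qed
  show ?thesis
  proof (intro exI[of _ C] conjI C0 allI impI; elim conjE)
    fix gs and W :: real and f
    assume gs: "set gs = G" and W: "1 \<le> W" and f: "f \<in> range (excitation \<sigma>)"
      and box: "sites f \<subseteq> lattice_box 0 W"
    interpret parallel_division \<sigma> \<omega> \<eta> gs h \<delta>
      using assms(3,4) \<delta> gap wpos by unfold_locales (auto simp: gs admissible_shifts_def)
    have f': "f \<in> eps_plus \<sigma>"
      using f box by (fastforce simp: eps_plus_def lattice_box_def)
    define M where "M = B * W"
    have M0: "0 \<le> M" using B0 W by (simp add: M_def)
    have M: "\<Phi> \<mu> \<le> M" if "\<mu> \<in> msupp f" for \<mu>
    proof -
      obtain u a where \<mu>: "\<mu> = (u, a)" by force
      have "u \<in> lattice_box 0 W" using that subsetD[OF box, of u] mem_sites[of u f] \<mu> by blast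
      then have "(\<Sum>i\<in>UNIV. \<omega> $ i * real_of_int (u $ i)) \<le> (\<Sum>i\<in>UNIV. \<omega> $ i * W)"
        by (intro sum_mono mult_left_mono) (auto simp: lattice_box_def wpos less_imp_le)
      moreover have "real (\<eta> a) \<le> (\<Sum>a\<in>UNIV. real (\<eta> a))"
        by (intro member_le_sum) auto
      \<comment> \<open>The shifts do not scale with the box; \<open>1 \<le> W\<close> absorbs them
        into a multiple of \<open>W\<close>.\<close>
      moreover have "1 * (\<Sum>a\<in>UNIV. real (\<eta> a)) \<le> W * (\<Sum>a\<in>UNIV. real (\<eta> a))"
        by (intro mult_right_mono W sum_nonneg) auto
      ultimately show ?thesis
        by (simp add: \<mu> Phi_def M_def B_def algebra_simps sum_distrib_left)
    qed
    have K_W: "real_of_int K \<le> real_of_int K * W" using K0 W by (simp add: mult_le_cancel_left1)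
    \<comment> \<open>Expanded so that linear arithmetic can treat each product as an atom.\<close>
    have CW: "C * W = R * M + 2 * (real_of_int K * W) + M / \<delta> + W"
      by (simp add: C_def M_def algebra_simps)
    have M_div: "M / \<omega> $ i \<le> R * M" for i
    proof -
      have "1 / \<omega> $ i \<le> R" unfolding R_def
        by (intro member_le_sum) (auto simp: wpos less_imp_le)
      then show ?thesis using mult_right_mono[OF _ M0] by fastforce
    qed
    have M_\<delta>: "0 \<le> M / \<delta>" using M0 \<delta> by simp
    show "\<exists>T::nat. real T \<le> C * W \<and> syndrome_at \<omega> \<eta> h gs f T = 0"
    proof (intro exI conjI)
      show "syndrome_at \<omega> \<eta> h gs f (nat \<lceil>M / \<delta>\<rceil>) = 0"
      proof (rule syn_eventually_0[OF f' M])
        have "M / \<delta> \<le> real (nat \<lceil>M / \<delta>\<rceil>)" by (rule real_nat_ceiling_ge)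
        then show "M \<le> real (nat \<lceil>M / \<delta>\<rceil>) * \<delta>" using \<delta> by (simp add: field_simps)
      qed
      have "real (nat \<lceil>M / \<delta>\<rceil>) \<le> M / \<delta> + 1" using M_\<delta> by linarith
      also have "\<dots> \<le> C * W"
        using W K0 K_W mult_nonneg_nonneg[OF R0 M0] unfolding CW by linarith
      finally show "real (nat \<lceil>M / \<delta>\<rceil>) \<le> C * W" .
    qed
    show "\<exists>p. \<forall>t. sites (syndrome_at \<omega> \<eta> h gs f t) \<subseteq> lattice_box p (C * W) \<and>
        sites (correction_at \<omega> \<eta> h gs f t) \<subseteq> lattice_box p (C * W)"
    \<comment> \<open>The lifts may stick out of the orthant by up to \<open>K\<close>, so the
      common corner is moved down by \<open>K\<close> in every coordinate.\<close>
    proof (intro exI[of _ "\<chi> i. - K"] allI conjI subsetI)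
      fix t u assume u: "u \<in> sites (syndrome_at \<omega> \<eta> h gs f t)"
      have "- K \<le> u $ i \<and> real_of_int (u $ i) \<le> - real_of_int K + C * W" for i
        using sites_syn[OF f' M u, of i] M_div[of i] K0 K_W M_\<delta> W unfolding CW by linarith
      then show "u \<in> lattice_box (\<chi> i. - K) (C * W)" by (simp add: lattice_box_def)
    next
      fix t v assume v: "v \<in> sites (correction_at \<omega> \<eta> h gs f t)"
      have "- K \<le> v $ i \<and> real_of_int (v $ i) \<le> M / \<omega> $ i + real_of_int K" for i
        by (rule sites_cor[OF f' M M0 K v]) (simp_all add: gs)
      then have "- K \<le> v $ i \<and> real_of_int (v $ i) \<le> - real_of_int K + C * W" for i
        using M_div[of i] K0 K_W M_\<delta> W unfolding CW by (smt (verit))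
      then show "v \<in> lattice_box (\<chi> i. - K) (C * W)" by (simp add: lattice_box_def)
    qed
  qed
qed

end
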